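(* Let $n\ge 2$ be an integer. Every null-polynomial $p\in\mathbb{Z}_n[x]$ has a unique decomposition of the form $$p(x)=\sum_{k=1}^{t(n)}q_k(x)\,b_k(x),$$ where $q_k\in\mathbb{Z}_{n/\alpha_k}[x]$ for every $k$, where $q_k$ has degree strictly less than $\beta_{k-1}-\beta_k$ if $k>1$, and where $\deg(q_1)=\deg(p)-\beta_1$ (with $q_1=0$ if $\deg(p)<\beta_1$).
   Context: $\mathbb{Z}_n=\mathbb{Z}/n\mathbb{Z}$. A null-polynomial in $\mathbb{Z}_n[x]$ is a polynomial $p\in\mathbb{Z}_n[x]$ with $p(x)=0$ for all $x\in\mathbb{Z}_n$. For a positive integer $k$ let $s(k):=\min\{j\in\mathbb{N}: k\mid j!\}$ (Smarandache function). For $n\ge 2$ let $q(n)$ be the smallest prime divisor of $n$, and consider the finite set $$\{s(\gcd(n,\alpha!)) : \alpha\in\mathbb{N},\ s(\gcd(n,\alpha!))\ge q(n)\}.$$ Let $t(n)$ be its cardinality and write its elements in descending order as $s(n)=\beta_1>\beta_2>\dots>\beta_{t(n)}=q(n)$. Put $\alpha_k:=\dfrac{n}{\gcd(n,\beta_k!)}$ and define the basic null-polynomials $b_k(x):=\alpha_k\prod_{i=1}^{\beta_k}(x+i)\in\mathbb{Z}_n[x]$ for $1\le k\le t(n)$. Since all coefficients of $b_k$ are multiples of $\alpha_k$, the product $q_k b_k\in\mathbb{Z}_n[x]$ is well defined for $q_k\in\mathbb{Z}_{n/\alpha_k}[x]$ (lift the coefficients of $q_k$ arbitrarily to $\mathbb{Z}_n$).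 The zero polynomial has degree $-\infty$. Equality is equality of polynomials in $\mathbb{Z}_n[x]$. *)

theory Defs
  imports
    "HOL-Algebra.UnivPoly"
    "HOL-Number_Theory.Residues"
    "HOL-Library.Extended_Real"
begin

section \<open>Polynomials over the integers modulo \<open>m\<close>\<close>

abbreviation Zmod :: "nat \<Rightarrow> int ring" where
  "Zmod m \<equiv> residue_ring (int m)"

abbreviation Zpoly :: "nat \<Rightarrow> (int, nat \<Rightarrow> int) up_ring" where
  "Zpoly m \<equiv> UP (Zmod m)"

definition null_polynomial :: "nat \<Rightarrow> (nat \<Rightarrow> int) \<Rightarrow> bool" where
  "null_polynomial n p \<longleftrightarrow>
     p \<in> carrier (Zpoly n) \<and>
     (\<forall>x \<in> carrier (Zmod n). eval (Zmod n) (Zmod n) id x p = \<zero>\<^bsub>Zmod n\<^esub>)"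

text \<open>The library's \<^const>\<open>deg\<close> assigns degree \<open>0\<close> to the zero polynomial; here it gets \<open>-\<infinity>\<close>.\<close>

definition degree_ext :: "('a, 'm) ring_scheme \<Rightarrow> (nat \<Rightarrow> 'a) \<Rightarrow> ereal" where
  "degree_ext R p = (if p = \<zero>\<^bsub>UP R\<^esub> then -\<infinity> else ereal (real (deg R p)))"

section \<open>Basic null-polynomials\<close>

definition smarandache :: "nat \<Rightarrow> nat" where
  "smarandache k = (LEAST j. k dvd fact j)"

definition smallest_prime_divisor :: "nat \<Rightarrow> nat" where
  "smallest_prime_divisor n = (LEAST p. prime p \<and> p dvd n)"

definition beta_set :: "nat \<Rightarrow> nat set" where
  "beta_set n =
     {smarandache (gcd n (fact a)) | a.
        smarandache (gcd n (fact a)) \<ge> smallest_prime_divisor n}"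

definition num_basic :: "nat \<Rightarrow> nat" where
  "num_basic n = card (beta_set n)"

text \<open>\<open>beta n k\<close> is the \<open>k\<close>-th largest element, with indices \<open>k = 1, \<dots>, num_basic n\<close>.\<close>

definition beta :: "nat \<Rightarrow> nat \<Rightarrow> nat" where
  "beta n k = rev (sorted_list_of_set (beta_set n)) ! (k - 1)"

definition alpha :: "nat \<Rightarrow> nat \<Rightarrow> nat" where
  "alpha n k = n div gcd n (fact (beta n k))"

text \<open>Integers are reduced modulo \<open>n\<close> because the carrier of \<^term>\<open>Zmod n\<close> is \<open>{0..n - 1}\<close>.\<close>

definition basic_null_poly :: "nat \<Rightarrow> nat \<Rightarrow> nat \<Rightarrow> int" where
  "basic_null_poly n k =
     (int (alpha n k) mod int n) \<odot>\<^bsub>Zpoly n\<^esub>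
     (\<Otimes>\<^bsub>Zpoly n\<^esub> i \<in> {1..beta n k}.
        up_ring.monom (Zpoly n) \<one>\<^bsub>Zmod n\<^esub> 1 \<oplus>\<^bsub>Zpoly n\<^esub>
        up_ring.monom (Zpoly n) (int i mod int n) 0)"

text \<open>
  A lift of a polynomial modulo \<open>n div alpha n k\<close> to one modulo \<open>n\<close>: every coefficient is
  represented by its least nonnegative integer representative, read modulo \<open>n\<close>. The lemma
  \<open>lift_mult_basic_null_poly\<close> below shows that any other choice of lift has the same
  product with \<open>basic_null_poly n k\<close>.
\<close>

definition lift_poly :: "nat \<Rightarrow> (nat \<Rightarrow> int) \<Rightarrow> (nat \<Rightarrow> int)" where
  "lift_poly n q = (\<lambda>i. q i mod int n)"

section \<open>Well-definedness\<close>

lemma smarandache_gcd_fact_le: "smarandache (gcd n (fact a)) \<le> n" if "n > 0"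
proof -
  have "n dvd fact n"
    using that by (simp add: dvd_fact)
  then have "gcd n (fact a) dvd fact n"
    by (meson dvd_trans gcd_dvd1)
  then show ?thesis
    unfolding smarandache_def by (rule Least_le)
qed

lemma finite_beta_set: "n > 0 \<Longrightarrow> finite (beta_set n)"
  by (rule finite_subset[of _ "{..n}"]) (auto simp: beta_set_def smarandache_gcd_fact_le)

lemma beta_bij_betw:
  assumes "n > 0"
  shows "bij_betw (beta n) {1..num_basic n} (beta_set n)"
proof -
  let ?xs = "rev (sorted_list_of_set (beta_set n))"
  have "bij_betw (\<lambda>i. ?xs ! i) {..<num_basic n} (beta_set n)"
    using bij_betw_nth[of ?xs "{..<num_basic n}" "beta_set n"] finite_beta_set[OF assms]
    by (simp add: num_basic_def)
  moreover have "bij_betw (\<lambda>k. k - 1) {1..num_basic n} {..<num_basic n}"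
    by (rule bij_betwI[of _ _ _ Suc]) auto
  ultimately have "bij_betw ((\<lambda>i. ?xs ! i) \<circ> (\<lambda>k. k - 1)) {1..num_basic n} (beta_set n)"
    by (rule bij_betw_trans[rotated])
  moreover have "(\<lambda>i. ?xs ! i) \<circ> (\<lambda>k. k - 1) = beta n"
    by (auto simp: beta_def fun_eq_iff)
  ultimately show ?thesis by simp
qed

lemma beta_strict_decreasing:
  assumes "n > 0" "1 \<le> j" "j < k" "k \<le> num_basic n"
  shows "beta n k < beta n j"
proof -
  let ?xs = "sorted_list_of_set (beta_set n)"
  have len: "length ?xs = num_basic n" by (simp add: num_basic_def)
  have "?xs ! (num_basic n - k) < ?xs ! (num_basic n - j)"
    using assms len strict_sorted_list_of_set[of "beta_set n"]
    by (intro sorted_wrt_nth_less[of "(<)"]) auto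
  then show ?thesis
    using assms len by (simp add: beta_def rev_nth)
qed

lemma lift_mult_basic_null_poly:
  assumes n: "n \<ge> 2"
    and q: "q \<in> carrier (Zpoly (n div alpha n k))"
    and Q: "Q \<in> carrier (Zpoly n)"
    and lift: "\<And>i. [Q i = q i] (mod int (n div alpha n k))"
  shows "lift_poly n q \<in> carrier (Zpoly n)"
    and "Q \<otimes>\<^bsub>Zpoly n\<^esub> basic_null_poly n k = lift_poly n q \<otimes>\<^bsub>Zpoly n\<^esub> basic_null_poly n k"
proof -
  interpret residues "int n" "Zmod n"
    using n by unfold_locales simp_all
  interpret UP_cring "Zmod n" "Zpoly n"
    by unfold_locales simp_all
  let ?m = "n div alpha n k" and ?a = "int (alpha n k) mod int n"
  let ?L = "lift_poly n q"
  from q obtain N where "\<forall>i>N. q i = 0"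
    by (auto simp: UP_def up_def bound_def residue_ring_def)
  then have N: "\<forall>i>N. ?L i = 0" by (simp add: lift_poly_def)
  have range: "?L i \<in> carrier (Zmod n)" for i
    using n by (simp add: lift_poly_def residue_ring_def)
  show L: "?L \<in> carrier (Zpoly n)"
    unfolding UP_def up_def bound_def
    using N range by (auto simp: residue_ring_def)
  have a: "?a \<in> carrier (Zmod n)"
    using n by (simp add: residue_ring_def)
  have "alpha n k dvd n"
    by (simp add: alpha_def div_dvd_iff_mult gcd_eq_0_iff)
  then have am: "int (alpha n k) * int ?m = int n"
    by (metis dvd_mult_div_cancel of_nat_mult)
  have eq: "(?a * Q i) mod int n = (?a * ?L i) mod int n" for i
  proof -
    have "int ?m dvd Q i - q i"
      using lift[of i] by (simp add: cong_iff_dvd_diff)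
    then have "int n dvd int (alpha n k) * (Q i - q i)"
      using am by (metis mult_dvd_mono dvd_refl)
    then have "[int (alpha n k) * Q i = int (alpha n k) * q i] (mod int n)"
      by (simp add: cong_iff_dvd_diff right_diff_distrib)
    then show ?thesis
      by (simp add: cong_def lift_poly_def mod_simps)
  qed
  have "?a \<odot>\<^bsub>Zpoly n\<^esub> Q = ?a \<odot>\<^bsub>Zpoly n\<^esub> ?L"
  proof (rule up_eqI)
    fix i
    show "up_ring.coeff (Zpoly n) (?a \<odot>\<^bsub>Zpoly n\<^esub> Q) i
        = up_ring.coeff (Zpoly n) (?a \<odot>\<^bsub>Zpoly n\<^esub> ?L) i"
      using a Q L by (simp add: UP_def residue_ring_def up_def eq)
  qed (use a Q L in simp_all)
  moreover have "Z \<otimes>\<^bsub>Zpoly n\<^esub> (?a \<odot>\<^bsub>Zpoly n\<^esub> X) = (?a \<odot>\<^bsub>Zpoly n\<^esub> Z) \<otimes>\<^bsub>Zpoly n\<^esub> X"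
    if "Z \<in> carrier (Zpoly n)" "X \<in> carrier (Zpoly n)" for Z X
    using that a by (metis UP_m_comm UP_smult_assoc2 UP_smult_closed)
  moreover have "(\<Otimes>\<^bsub>Zpoly n\<^esub> i \<in> {1..beta n k}.
        up_ring.monom (Zpoly n) \<one>\<^bsub>Zmod n\<^esub> 1 \<oplus>\<^bsub>Zpoly n\<^esub>
        up_ring.monom (Zpoly n) (int i mod int n) 0) \<in> carrier (Zpoly n)"
    using n by (intro P.finprod_closed Pi_I P.a_closed monom_closed) (auto simp: residue_ring_def)
  ultimately show "Q \<otimes>\<^bsub>Zpoly n\<^esub> basic_null_poly n k = ?L \<otimes>\<^bsub>Zpoly n\<^esub> basic_null_poly n k"
    using Q L by (simp add: basic_null_poly_def)
qed

end

theory Submission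
  imports Defs "HOL-Computational_Algebra.Polynomial"
begin

text \<open>
  Write \<open>(x)\<^sub>j = (x + 1) \<cdots> (x + j)\<close>. If an integer polynomial of degree at most \<open>d\<close> takes only
  values divisible by \<open>n\<close>, then so does its \<open>d\<close>-th difference, which is the constant \<open>d! c\<close> for the
  coefficient \<open>c\<close> of \<open>x\<^sup>d\<close>. Hence \<open>c\<close> is a multiple of \<open>n / gcd(n, d!)\<close>
  (\<open>null_imp_dvd_fact_mult_coeff\<close>, \<open>div_gcd_fact_dvd\<close>).

  The number \<open>gcd(n, d!)\<close> is \<open>1\<close> for \<open>d < q(n)\<close>, and afterwards it changes exactly when \<open>d\<close> reaches
  some \<open>\<beta>\<^sub>k\<close>: on the block \<open>\<beta>\<^sub>k \<le> d < \<beta>\<^sub>k\<^sub>-\<^sub>1\<close> it equals \<open>gcd(n, \<beta>\<^sub>k!)\<close>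
  (\<open>block_obtain\<close>; the block of \<open>\<beta>\<^sub>1\<close> is unbounded above). So in this block
  \<open>c = \<alpha>\<^sub>k e\<close> for some \<open>e\<close>, and subtracting \<open>e x\<^bsup>d-\<beta>\<^sub>k\<^esup> b\<^sub>k\<close> lowers the degree and leaves a
  null-polynomial; the monomial subtracted respects the bound on the degree of \<open>q\<^sub>k\<close>. Below \<open>q(n)\<close>,
  the coefficient vanishes modulo \<open>n\<close>. Induction on the degree gives the existence
  (\<open>null_decomposition_ex\<close>).

  For uniqueness, the degree bounds make the terms triangular: all terms after the \<open>k\<close>-th have
  degree below \<open>\<beta>\<^sub>k\<close>, while a nonzero \<open>k\<close>-th term \<open>(\<alpha>\<^sub>k q\<^sub>k) (x)\<^bsub>\<beta>\<^sub>k\<^esub>\<close> has degree at least \<open>\<beta>\<^sub>k\<close>, because the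
  second factor is monic. A vanishing sum therefore forces \<open>\<alpha>\<^sub>k q\<^sub>k = 0\<close> modulo \<open>n\<close>, that is
  \<open>q\<^sub>k = 0\<close> modulo \<open>n / \<alpha>\<^sub>k\<close>, for \<open>k = 1, 2, \<dots>\<close> in turn (\<open>decomposition_unique\<close>). Since
  \<open>\<alpha>\<^sub>1 = 1\<close>, the same comparison for \<open>k = 1\<close> yields the degree of \<open>q\<^sub>1\<close>
  (\<open>degree_leading_quotient\<close>).

  The whole argument takes place in \<open>\<int>[x]\<close>, with congruences modulo integers. Coefficientwise reduction modulo \<open>n\<close> is
  a surjective ring homomorphism onto the polynomials over the residue ring and carries it over.
\<close>

section \<open>Leading coefficients and differences\<close>

lemma coeff_mult_eq_0_above:
  fixes Q M :: "'a::comm_semiring_0 poly"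
  assumes Q: "\<And>i. i \<ge> e \<Longrightarrow> poly.coeff Q i = 0" and i: "i \<ge> e + degree M"
  shows "poly.coeff (Q * M) i = 0"
proof (cases "Q = 0")
  case False
  then have "degree Q < e"
    using Q leading_coeff_0_iff not_le by blast
  then show ?thesis
    using i degree_mult_le[of Q M] by (intro coeff_eq_0) linarith
qed simp

text \<open>
  Read modulo \<open>c\<close>: multiplying by a monic polynomial only moves the leading coefficient, although
  \<open>Q\<close> itself may have nonzero coefficients above \<open>e\<close>.
\<close>

lemma coeff_mult_monic_cong:
  fixes Q M :: "'a::comm_ring_1 poly"
  assumes Q: "\<And>i. i > e \<Longrightarrow> c dvd poly.coeff Q i" and M: "lead_coeff M = 1"
  shows "c dvd poly.coeff (Q * M) (e + degree M) - poly.coeff Q e"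
proof -
  let ?f = "\<lambda>i. poly.coeff Q i * poly.coeff M (e + degree M - i)"
  have "poly.coeff (Q * M) (e + degree M) = ?f e + sum ?f ({..e + degree M} - {e})"
    unfolding coeff_mult by (rule sum.remove) auto
  then have "poly.coeff (Q * M) (e + degree M) - poly.coeff Q e = sum ?f ({..e + degree M} - {e})"
    using M by simp
  moreover have "c dvd ?f i" if "i \<in> {..e + degree M} - {e}" for i
  proof (cases "i < e")
    case True
    then show ?thesis by (simp add: coeff_eq_0)
  next
    case False
    with that Q show ?thesis by auto
  qed
  ultimately show ?thesis
    by (simp only:) (rule dvd_sum)
qed

text \<open>
  The difference operator acts on leading terms like the derivative. For \<open>d = 0\<close> the first conjunct
  says that the difference vanishes, and the second becomes trivial.
\<close>

lemma coeff_difference: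
  fixes P :: "'a::comm_ring_1 poly"
  assumes "\<And>i. i > d \<Longrightarrow> poly.coeff P i = 0"
  shows "(\<forall>i\<ge>d. poly.coeff (pcompose P [:1, 1:] - P) i = 0) \<and>
    poly.coeff (pcompose P [:1, 1:] - P) (d - 1) = of_nat d * poly.coeff P d"
  using assms
proof (induction P arbitrary: d)
  case 0
  show ?case by simp
next
  case (pCons a P)
  define D where "D = pcompose P [:1, 1:] - P"
  \<comment> \<open>\<open>(a + (x + 1) P(x + 1)) - (a + x P(x)) = (x + 1) (P(x + 1) - P(x)) + P(x)\<close>\<close>
  have D: "pcompose (pCons a P) [:1, 1:] - pCons a P = pCons 0 D + D + P"
    by (simp add: D_def pcompose_pCons algebra_simps)
  show ?case
  proof (cases d)
    case 0
    have "P = 0"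
      using pCons.prems[of "Suc i" for i] 0 by (intro poly_eqI) auto
    then show ?thesis using 0 by (simp add: pcompose_pCons)
  next
    case (Suc e)
    have "\<And>i. i > e \<Longrightarrow> poly.coeff P i = 0"
      using pCons.prems[of "Suc i" for i] Suc by simp
    with pCons.IH[of e] have
      *: "\<And>i. i \<ge> e \<Longrightarrow> poly.coeff D i = 0" "poly.coeff D (e - 1) = of_nat e * poly.coeff P e"
        "\<And>i. i > e \<Longrightarrow> poly.coeff P i = 0"
      by (auto simp: D_def)
    have "poly.coeff (pCons 0 D + D + P) i = 0" if "i \<ge> d" for i
      using that Suc * by (cases i) auto
    moreover have "poly.coeff (pCons 0 D + D + P) e = of_nat d * poly.coeff P e"
      using * Suc by (cases e) (auto simp: algebra_simps)
    ultimately show ?thesis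
      unfolding D using Suc by simp
  qed
qed

text \<open>The \<open>d\<close>-th difference of \<open>P\<close> is the constant \<open>d!\<close> times its coefficient at \<open>d\<close>.\<close>

lemma null_imp_dvd_fact_mult_coeff:
  fixes P :: "'a::{comm_ring_1, ring_char_0} poly"
  assumes "\<And>x. c dvd poly P x" and "\<And>i. i > d \<Longrightarrow> poly.coeff P i = 0"
  shows "c dvd fact d * poly.coeff P d"
  using assms
proof (induction d arbitrary: P)
  case 0
  have "P = [:poly.coeff P 0:]"
    by (intro poly_eqI) (use 0(2) in \<open>auto simp: coeff_pCons split: nat.split\<close>)
  then have "poly P 0 = poly.coeff P 0"
    by (metis mult_zero_left poly_0_coeff_0)
  then show ?case using 0(1)[of 0] by simp
next
  case (Suc d)
  let ?D = "pcompose P [:1, 1:] - P"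
  have "c dvd fact d * poly.coeff ?D d"
  proof (rule Suc.IH)
    show "c dvd poly ?D x" for x
      using Suc.prems(1) by (simp add: poly_pcompose)
    show "poly.coeff ?D i = 0" if "i > d" for i
      using coeff_difference[of "Suc d" P] Suc.prems(2) that by simp
  qed
  also have "poly.coeff ?D d = of_nat (Suc d) * poly.coeff P (Suc d)"
    using coeff_difference[of "Suc d" P] Suc.prems(2) by simp
  finally show ?case by (simp add: algebra_simps)
qed

section \<open>Rising factorials\<close>

text \<open>Shifted by one from the usual rising factorial \<open>x (x + 1) \<cdots> (x + m - 1)\<close>.\<close>

definition rising :: "nat \<Rightarrow> int poly" where
  "rising m = (\<Prod>i\<in>{1..m}. [:int i, 1:])"

lemma degree_rising [simp]: "degree (rising m) = m"
  unfolding rising_def by (subst degree_prod_sum_eq) auto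

lemma lead_coeff_rising: "lead_coeff (rising m) = 1"
  unfolding rising_def by (subst lead_coeff_prod) auto

lemma fact_dvd_poly_rising: "fact m dvd poly (rising m) x"
proof -
  have "poly (rising m) x = (\<Prod>i=0..<m. x + 1 + int i)"
    unfolding rising_def poly_prod
    by (rule prod.reindex_bij_witness[of _ Suc "\<lambda>i. i - 1"]) auto
  also have "\<dots> = pochhammer (x + 1) m"
    by (simp add: pochhammer_prod)
  also have "fact m dvd \<dots>"
    by (rule fact_dvd_pochhammer)
  finally show ?thesis .
qed

section \<open>Blocks of degrees with constant gcd of \<open>n\<close> and the factorial\<close>

lemma smallest_prime_divisor:
  assumes "n \<ge> 2"
  shows "prime (smallest_prime_divisor n)" "smallest_prime_divisor n dvd n"
    "\<And>p. prime p \<Longrightarrow> p dvd n \<Longrightarrow> smallest_prime_divisor n \<le> p"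
proof -
  have "\<exists>p. prime p \<and> p dvd n"
    using assms prime_factor_nat[of n] by auto
  from LeastI_ex[OF this]
  show "prime (smallest_prime_divisor n)" "smallest_prime_divisor n dvd n"
    by (auto simp: smallest_prime_divisor_def)
  show "\<And>p. prime p \<Longrightarrow> p dvd n \<Longrightarrow> smallest_prime_divisor n \<le> p"
    unfolding smallest_prime_divisor_def by (rule Least_le) simp
qed

lemma dvd_fact_smarandache: "m > 0 \<Longrightarrow> m dvd fact (smarandache m)"
  unfolding smarandache_def by (rule LeastI[of _ m]) (simp add: dvd_fact)

lemma smarandache_le: "m dvd fact j \<Longrightarrow> smarandache m \<le> j"
  unfolding smarandache_def by (rule Least_le)

text \<open>The primes dividing \<open>d!\<close> are those up to \<open>d\<close>, and none of these divides \<open>n\<close>.\<close>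

lemma gcd_fact_eq_1:
  assumes "n \<ge> 2" "d < smallest_prime_divisor n"
  shows "gcd n (fact d) = 1"
proof (rule ccontr)
  assume "gcd n (fact d) \<noteq> 1"
  then obtain p where p: "prime p" "p dvd n" "p dvd fact d"
    by (metis prime_factor_nat gcd_greatest_iff)
  then have "p \<le> d" by (simp add: prime_dvd_fact_iff)
  with smallest_prime_divisor(3)[of n p] p assms show False by simp
qed

text \<open>
  The Smarandache value \<open>s\<close> of \<open>gcd(n, d!)\<close> is the first argument at which the factorial has
  the same gcd with \<open>n\<close> as \<open>d!\<close>, so it is one of the \<open>\<beta>\<^sub>j\<close>, and it is at most \<open>d\<close>. The largest
  \<open>\<beta>\<^sub>k \<le> d\<close> then lies between \<open>s\<close> and \<open>d\<close> and has the same gcd again.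
\<close>

lemma block_obtain:
  assumes n: "n \<ge> 2" and d: "smallest_prime_divisor n \<le> d"
  obtains k where "k \<in> {1..num_basic n}" "beta n k \<le> d" "k > 1 \<Longrightarrow> d < beta n (k - 1)"
    "gcd n (fact (beta n k)) = gcd n (fact d)"
proof -
  let ?g = "gcd n (fact d)" and ?q = "smallest_prime_divisor n"
  define s where "s = smarandache ?g"
  have g: "?g > 0" using n by simp
  have q: "prime ?q" "?q dvd n" using n by (auto simp: smallest_prime_divisor)
  have gs: "?g dvd fact s"
    unfolding s_def by (rule dvd_fact_smarandache[OF g])
  have "?q dvd ?g"
    using q d by (simp add: prime_dvd_fact_iff)
  then have "?q dvd fact s" using gs dvd_trans by blast
  then have "?q \<le> s" using q by (simp add: prime_dvd_fact_iff)
  then have "s \<in> beta_set n" by (auto simp: beta_set_def s_def)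
  then obtain j where j: "j \<in> {1..num_basic n}" "beta n j = s"
    using beta_bij_betw[of n] n by (metis bij_betw_imp_surj_on imageE less_le_trans pos2)
  have "s \<le> d" unfolding s_def by (rule smarandache_le) simp
  \<comment> \<open>The \<open>\<beta>\<^sub>k\<close> decrease, so the largest of them not exceeding \<open>d\<close> has the least index.\<close>
  define k where "k = (LEAST k. k \<in> {1..num_basic n} \<and> beta n k \<le> d)"
  have k: "k \<in> {1..num_basic n}" "beta n k \<le> d"
    using LeastI[of "\<lambda>k. k \<in> {1..num_basic n} \<and> beta n k \<le> d" j] j \<open>s \<le> d\<close>
    by (auto simp: k_def)
  have "k \<le> j"
    unfolding k_def by (rule Least_le) (use j \<open>s \<le> d\<close> in simp)
  then have "s \<le> beta n k"
    using beta_strict_decreasing[of n k j] k j n by (cases "k = j") auto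
  show ?thesis
  proof (rule that[OF k])
    show "d < beta n (k - 1)" if "k > 1"
    proof -
      have "\<not> (k - 1 \<in> {1..num_basic n} \<and> beta n (k - 1) \<le> d)"
        using not_less_Least[of "k - 1" "\<lambda>k. k \<in> {1..num_basic n} \<and> beta n k \<le> d"] that
        unfolding k_def[symmetric] by linarith
      then show ?thesis using k that by auto
    qed
    show "gcd n (fact (beta n k)) = ?g"
    proof (rule dvd_antisym)
      show "gcd n (fact (beta n k)) dvd ?g"
        using k(2) by (meson dvd_trans fact_dvd gcd_dvd1 gcd_dvd2 gcd_greatest)
      show "?g dvd gcd n (fact (beta n k))"
        using gs \<open>s \<le> beta n k\<close> by (meson dvd_trans fact_dvd gcd_dvd1 gcd_greatest)
    qed
  qed
qed

lemma num_basic_ge_1: "n \<ge> 2 \<Longrightarrow> num_basic n \<ge> 1"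
  using block_obtain[of n "smallest_prime_divisor n"] by fastforce

lemma alpha_mult_gcd: "alpha n k * gcd n (fact (beta n k)) = n"
  by (simp add: alpha_def)

lemma div_alpha: "n > 0 \<Longrightarrow> n div alpha n k = gcd n (fact (beta n k))"
  using alpha_mult_gcd[of n k] by (metis nonzero_mult_div_cancel_left mult_zero_left not_gr0)

text \<open>Cancel \<open>gcd(n, d!)\<close> on both sides; the remaining cofactors of \<open>n\<close> and \<open>d!\<close> are coprime.\<close>

lemma div_gcd_fact_dvd:
  fixes c :: int
  assumes "n > 0" "int n dvd fact d * c"
  shows "int (n div gcd n (fact d)) dvd c"
proof -
  let ?g = "gcd n (fact d)"
  have "int n = int ?g * int (n div ?g)" "fact d = int ?g * int (fact d div ?g)"
    by (simp_all flip: of_nat_mult)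
  then have "int ?g * int (n div ?g) dvd int ?g * (int (fact d div ?g) * c)"
    using assms(2) by (metis mult.assoc)
  then have "int (n div ?g) dvd int (fact d div ?g) * c"
    using assms(1) by simp
  moreover have "coprime (n div ?g) (fact d div ?g)"
    using assms(1) by (simp add: div_gcd_coprime)
  ultimately show ?thesis
    using coprime_dvd_mult_right_iff coprime_int_iff by blast
qed

text \<open>
  \<open>\<beta>\<^sub>1\<close> is at least the \<open>\<beta>\<^sub>k\<close> belonging to the degree \<open>n\<close>, whose factorial is divisible by \<open>n\<close>. This
  is what makes \<open>b\<^sub>1\<close> monic.
\<close>

lemma alpha_1:
  assumes "n \<ge> 2"
  shows "alpha n 1 = 1"
proof -
  have "smallest_prime_divisor n \<le> n"
    using assms smallest_prime_divisor(2)[of n] by (simp add: dvd_imp_le)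
  then obtain k where k: "k \<in> {1..num_basic n}" "gcd n (fact (beta n k)) = gcd n (fact n)"
    using block_obtain[of n n] assms by blast
  have "gcd n (fact n) = n" using assms by (simp add: gcd_nat.absorb1 dvd_fact)
  with k have "n dvd fact (beta n k)" by (metis gcd_dvd2)
  moreover have "beta n k \<le> beta n 1"
    using beta_strict_decreasing[of n 1 k] k assms by (cases "k = 1") auto
  ultimately have "n dvd fact (beta n 1)" by (meson dvd_trans fact_dvd)
  then show ?thesis using assms by (simp add: alpha_def gcd_nat.absorb1)
qed

section \<open>Decomposition of integer polynomials modulo \<open>n\<close>\<close>

definition int_basic :: "nat \<Rightarrow> nat \<Rightarrow> int poly" where
  "int_basic n k = smult (int (alpha n k)) (rising (beta n k))"

text \<open>
  The values of the rising factorial are divisible by \<open>\<beta>\<^sub>k!\<close>, hence by \<open>gcd(n, \<beta>\<^sub>k!)\<close>, which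
  \<open>\<alpha>\<^sub>k\<close> completes to \<open>n\<close>.
\<close>

lemma dvd_poly_int_basic: "int n dvd poly (int_basic n k) x"
proof -
  have "int n = int (alpha n k) * int (gcd n (fact (beta n k)))"
    by (metis alpha_mult_gcd of_nat_mult)
  also have "int (gcd n (fact (beta n k))) dvd fact (beta n k)"
    by (metis gcd_dvd2 of_nat_dvd_iff of_nat_fact)
  then have "int (alpha n k) * int (gcd n (fact (beta n k))) dvd
      int (alpha n k) * poly (rising (beta n k)) x"
    by (intro mult_dvd_mono dvd_refl) (rule dvd_trans[OF _ fact_dvd_poly_rising])
  finally show ?thesis by (simp add: int_basic_def)
qed

text \<open>
  The strict degree bound is expressed by vanishing coefficients, which treats the zero polynomial
  like any other. Divisibility by the constant polynomial \<open>n\<close> is congruence of all coefficients.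
\<close>

lemma null_decomposition_ex:
  fixes P :: "int poly"
  assumes n: "n \<ge> 2"
    and "\<And>x. int n dvd poly P x" and "\<And>i. i \<ge> d \<Longrightarrow> poly.coeff P i = 0"
  shows "\<exists>Q. [:int n:] dvd P - (\<Sum>k\<in>{1..num_basic n}. Q k * int_basic n k) \<and>
    (\<forall>k\<in>{1<..num_basic n}. \<forall>i\<ge>beta n (k - 1) - beta n k. poly.coeff (Q k) i = 0)"
  using assms(2,3)
proof (induction d arbitrary: P)
  case 0
  then have "P = 0" by (intro poly_eqI) simp
  then show ?case by (intro exI[of _ "\<lambda>_. 0"]) simp
next
  case (Suc d)
  define c where "c = poly.coeff P d"
  have c: "int (n div gcd n (fact d)) dvd c"
    unfolding c_def using n Suc.prems
    by (intro div_gcd_fact_dvd null_imp_dvd_fact_mult_coeff) auto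
  show ?case
  proof (cases "d < smallest_prime_divisor n")
    case True
    with c n have nc: "int n dvd c" by (simp add: gcd_fact_eq_1)
    let ?P = "P - Polynomial.monom c d"
    have "int n dvd poly ?P x" for x
      using Suc.prems(1)[of x] nc by (simp add: poly_monom)
    moreover have "poly.coeff ?P i = 0" if "i \<ge> d" for i
      using Suc.prems(2)[of i] that by (cases "i = d") (auto simp: c_def)
    ultimately obtain Q where
      Q: "[:int n:] dvd ?P - (\<Sum>k\<in>{1..num_basic n}. Q k * int_basic n k)"
        "\<forall>k\<in>{1<..num_basic n}. \<forall>i\<ge>beta n (k - 1) - beta n k. poly.coeff (Q k) i = 0"
      using Suc.IH[of ?P] by blast
    have "[:int n:] dvd Polynomial.monom c d"
      using nc by (simp add: const_poly_dvd_iff)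
    from dvd_add[OF Q(1) this] Q(2) show ?thesis
      by (intro exI[of _ Q]) (simp add: algebra_simps)
  next
    case False
    then obtain k where k: "k \<in> {1..num_basic n}" "beta n k \<le> d" "k > 1 \<Longrightarrow> d < beta n (k - 1)"
        "gcd n (fact (beta n k)) = gcd n (fact d)"
      using block_obtain[OF n, of d] by (metis not_less)
    from c k(4) obtain e where e: "c = int (alpha n k) * e"
      by (auto simp: alpha_def)
    \<comment> \<open>\<open>T\<close> is the next term of the quotient \<open>q\<^sub>k\<close>; it cancels the coefficient of \<open>x\<^sup>d\<close> exactly.\<close>
    define T where "T = Polynomial.monom e (d - beta n k)"
    let ?P = "P - T * int_basic n k"
    have "int n dvd poly ?P x" for x
      using Suc.prems(1)[of x] dvd_poly_int_basic[of n k x] by simp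
    moreover have "poly.coeff ?P i = 0" if "i \<ge> d" for i
    proof (cases "i = d")
      case True
      have "poly.coeff (T * int_basic n k) d = e * int (alpha n k) * poly.coeff (rising (beta n k)) (beta n k)"
        using k(2) by (simp add: T_def coeff_monom_mult int_basic_def)
      also have "\<dots> = c"
        using lead_coeff_rising[of "beta n k"] by (simp add: e)
      finally show ?thesis by (simp add: True c_def)
    next
      case False
      with that k(2) show ?thesis using Suc.prems(2)[of i]
        by (auto simp: T_def coeff_monom_mult int_basic_def coeff_eq_0)
    qed
    ultimately obtain Q where
      Q: "[:int n:] dvd ?P - (\<Sum>k\<in>{1..num_basic n}. Q k * int_basic n k)"
        "\<forall>k\<in>{1<..num_basic n}. \<forall>i\<ge>beta n (k - 1) - beta n k. poly.coeff (Q k) i = 0"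
      using Suc.IH[of ?P] by blast
    let ?Q = "Q(k := Q k + T)"
    have "(\<Sum>j\<in>{1..num_basic n}. ?Q j * int_basic n j) =
        (\<Sum>j\<in>{1..num_basic n}. Q j * int_basic n j + (if j = k then T * int_basic n k else 0))"
      by (rule sum.cong) (auto simp: algebra_simps)
    also have "\<dots> = (\<Sum>j\<in>{1..num_basic n}. Q j * int_basic n j) + T * int_basic n k"
      using k(1) by (simp add: sum.distrib)
    finally have "[:int n:] dvd P - (\<Sum>j\<in>{1..num_basic n}. ?Q j * int_basic n j)"
      using Q(1) by (simp add: algebra_simps)
    moreover have "poly.coeff (?Q j) i = 0"
      if "j \<in> {1<..num_basic n}" "i \<ge> beta n (j - 1) - beta n j" for i j
      using Q(2) that k(2,3) by (auto simp: T_def)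
    ultimately show ?thesis by (intro exI[of _ ?Q]) blast
  qed
qed

text \<open>For \<open>k > j\<close> the \<open>k\<close>-th term has degree less than \<open>\<beta>\<^sub>k\<^sub>-\<^sub>1 \<le> \<beta>\<^sub>j\<close>.\<close>

lemma coeff_tail_eq_0:
  assumes n: "n > 0"
    and Q: "\<And>k i. k \<in> {1<..num_basic n} \<Longrightarrow> i \<ge> beta n (k - 1) - beta n k \<Longrightarrow> poly.coeff (Q k) i = 0"
    and j: "1 \<le> j" and i: "i \<ge> beta n j"
  shows "poly.coeff (\<Sum>k\<in>{j<..num_basic n}. Q k * int_basic n k) i = 0"
proof -
  have "poly.coeff (Q k * int_basic n k) i = 0" if k: "k \<in> {j<..num_basic n}" for k
  proof (rule coeff_mult_eq_0_above)
    show "poly.coeff (Q k) i = 0" if "i \<ge> beta n (k - 1) - beta n k" for i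
      using Q[of k i] that k j by simp
    have "beta n k < beta n (k - 1)"
      using k j n by (intro beta_strict_decreasing) auto
    moreover have "beta n (k - 1) \<le> beta n j"
      using k j n beta_strict_decreasing[of n j "k - 1"] by (cases "j = k - 1") (auto intro: less_imp_le)
    moreover have "degree (int_basic n k) \<le> beta n k"
      by (simp add: int_basic_def)
    ultimately show "i \<ge> beta n (k - 1) - beta n k + degree (int_basic n k)"
      using i by linarith
  qed
  then show ?thesis by (simp add: coeff_sum)
qed

text \<open>
  Suppose that the terms before the \<open>k\<close>-th already vanish modulo \<open>n\<close>. If \<open>e\<close> were the largest index at
  which \<open>\<alpha>\<^sub>k D\<^sub>k\<close> has a nonzero coefficient modulo \<open>n\<close>, this coefficient would reappear at
  \<open>e + \<beta>\<^sub>k\<close> in the \<open>k\<close>-th term, where the later terms contribute nothing.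
\<close>

lemma decomposition_unique:
  assumes n: "n \<ge> 2"
    and D: "\<And>k i. k \<in> {1<..num_basic n} \<Longrightarrow> i \<ge> beta n (k - 1) - beta n k \<Longrightarrow> poly.coeff (D k) i = 0"
    and sum: "[:int n:] dvd (\<Sum>k\<in>{1..num_basic n}. D k * int_basic n k)"
    and k: "k \<in> {1..num_basic n}"
  shows "[:int (n div alpha n k):] dvd D k"
proof -
  have "[:int n:] dvd smult (int (alpha n k)) (D k)"
    using k
  proof (induction k rule: less_induct)
    case (less k)
    let ?f = "\<lambda>k. D k * int_basic n k"
    let ?A = "smult (int (alpha n k)) (D k)"
    have swap: "?f j = smult (int (alpha n j)) (D j) * rising (beta n j)" for j
      by (simp add: int_basic_def)
    have "{1..num_basic n} = {1..<k} \<union> {k} \<union> {k<..num_basic n}"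
      using less.prems by auto
    then have "sum ?f {1..num_basic n} = sum ?f {1..<k} + ?f k + sum ?f {k<..num_basic n}"
      by (simp only:) (subst sum.union_disjoint, auto)+
    moreover have "[:int n:] dvd sum ?f {1..<k}"
      using less.IH less.prems by (intro dvd_sum) (auto simp: swap simp del: mult_smult_left)
    ultimately have rest: "[:int n:] dvd ?f k + sum ?f {k<..num_basic n}"
      using sum by (simp add: add.assoc dvd_add_right_iff)
    show ?case
    proof (rule ccontr)
      assume "\<not> ?thesis"
      then have ex: "\<exists>e. \<not> int n dvd poly.coeff ?A e"
        by (simp add: const_poly_dvd_iff)
      define e where "e = Max {e. \<not> int n dvd poly.coeff ?A e}"
      have fin: "finite {e. \<not> int n dvd poly.coeff ?A e}"
        by (rule finite_subset[of _ "{..degree ?A}"]) (auto, metis coeff_eq_0 dvd_0_right not_le mult_zero_right)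
      have e: "\<not> int n dvd poly.coeff ?A e"
        using Max_in[OF fin] ex by (auto simp: e_def)
      have above: "int n dvd poly.coeff ?A i" if "i > e" for i
        using Max_ge[OF fin, of i] that by (auto simp: e_def)
      have "int n dvd poly.coeff (?A * rising (beta n k)) (e + beta n k) - poly.coeff ?A e"
        using coeff_mult_monic_cong[of e "int n" ?A "rising (beta n k)"] above lead_coeff_rising
        by simp
      moreover have "poly.coeff (sum ?f {k<..num_basic n}) (e + beta n k) = 0"
        using n D less.prems by (intro coeff_tail_eq_0) auto
      then have "int n dvd poly.coeff (?A * rising (beta n k)) (e + beta n k)"
        using rest by (auto simp: const_poly_dvd_iff swap simp del: mult_smult_left coeff_smult dest: spec[of _ "e + beta n k"])
      ultimately show False
        using e by (metis dvd_diff_right_iff)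
    qed
  qed
  then have "int n dvd int (alpha n k) * poly.coeff (D k) i" for i
    by (simp add: const_poly_dvd_iff)
  moreover have "int n = int (alpha n k) * int (n div alpha n k)" "alpha n k > 0"
    using alpha_mult_gcd[of n k] n div_alpha[of n k] by (auto simp flip: of_nat_mult intro: Nat.gr0I)
  ultimately show ?thesis
    by (simp add: const_poly_dvd_iff)
qed

section \<open>Reduction of integer polynomials to the residue ring\<close>

definition reduce :: "nat \<Rightarrow> int poly \<Rightarrow> nat \<Rightarrow> int" where
  "reduce m P = (\<lambda>i. poly.coeff P i mod int m)"

lemma reduce_carrier: "m > 0 \<Longrightarrow> reduce m P \<in> carrier (Zpoly m)"
  unfolding UP_def up_def bound_def reduce_def
  by (auto simp: residue_ring_def Polynomial.coeff_eq_0 intro!: exI[of _ "degree P"])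

lemma reduce_eq_iff: "reduce m P = reduce m Q \<longleftrightarrow> [:int m:] dvd P - Q"
  by (simp add: reduce_def fun_eq_iff const_poly_dvd_iff mod_eq_dvd_iff)

text \<open>
  Elements of the polynomial ring over the residues are functions with values in
  \<open>{0..m - 1}\<close> and finite support. \<open>Abs_poly\<close> reads them as integer polynomials, and is
  thus a section of the reduction.
\<close>

lemma coeff_Abs_carrier:
  assumes "p \<in> carrier (Zpoly m)"
  shows "poly.coeff (Abs_poly p) = p"
proof -
  from assms obtain N where "\<forall>i>N. p i = 0"
    by (auto simp: UP_def up_def bound_def residue_ring_def)
  then show ?thesis by (intro coeff_Abs_poly) auto
qed

lemma carrier_coeff_mod:
  assumes "p \<in> carrier (Zpoly m)"
  shows "p i mod int m = p i"
proof -
  have "p i \<in> {0..int m - 1}"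
    using assms by (auto simp: UP_def up_def residue_ring_def)
  then show ?thesis by simp
qed

lemma reduce_Abs_carrier: "p \<in> carrier (Zpoly m) \<Longrightarrow> reduce m (Abs_poly p) = p"
  by (simp add: reduce_def coeff_Abs_carrier carrier_coeff_mod)

lemma lift_poly_eq_reduce:
  "q \<in> carrier (Zpoly m) \<Longrightarrow> lift_poly n q = reduce n (Abs_poly q)"
  by (simp add: reduce_def lift_poly_def coeff_Abs_carrier)

lemma deg_eq_degree:
  assumes "q \<in> carrier (Zpoly m)"
  shows "deg (Zmod m) q = degree (Abs_poly q)"
  using assms unfolding deg_def degree_def bound_def
  by (simp add: coeff_Abs_carrier[OF assms] UP_def residue_ring_def)

lemma degree_ext_eq:
  assumes "q \<in> carrier (Zpoly m)"
  shows "degree_ext (Zmod m) q =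
    (if Abs_poly q = 0 then -\<infinity> else ereal (real (degree (Abs_poly q))))"
proof -
  have "q = \<zero>\<^bsub>Zpoly m\<^esub> \<longleftrightarrow> Abs_poly q = 0"
    using coeff_Abs_carrier[OF assms]
    by (auto simp: UP_def residue_ring_def poly_eq_iff fun_eq_iff)
  then show ?thesis
    using deg_eq_degree[OF assms] by (simp add: degree_ext_def)
qed

lemma degree_ext_less_iff:
  assumes "q \<in> carrier (Zpoly m)"
  shows "degree_ext (Zmod m) q < ereal (real N) \<longleftrightarrow> (\<forall>i\<ge>N. poly.coeff (Abs_poly q) i = 0)"
proof (cases "Abs_poly q = 0")
  case False
  then have "degree (Abs_poly q) < N \<longleftrightarrow> (\<forall>i\<ge>N. poly.coeff (Abs_poly q) i = 0)"
    by (metis coeff_eq_0 leading_coeff_0_iff not_le order_less_le_trans)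
  with False show ?thesis by (simp add: degree_ext_eq[OF assms])
qed (simp add: degree_ext_eq[OF assms])

context
  fixes n :: nat
  assumes n: "n \<ge> 2"
begin

interpretation residues "int n" "Zmod n"
  using n by unfold_locales simp_all

interpretation UP_cring "Zmod n" "Zpoly n"
  by unfold_locales simp_all

lemma reduce_closed [simp]: "reduce n P \<in> carrier (Zpoly n)"
  using n by (simp add: reduce_carrier)

lemma reduce_in_up [simp]: "reduce n P \<in> up (Zmod n)"
  using reduce_closed[of P] by (simp add: UP_def)

lemma reduce_add: "reduce n P \<oplus>\<^bsub>Zpoly n\<^esub> reduce n Q = reduce n (P + Q)"
  using reduce_in_up[of P] reduce_in_up[of Q]
  by (simp add: UP_def) (simp add: reduce_def add_cong)

lemma reduce_mult: "reduce n P \<otimes>\<^bsub>Zpoly n\<^esub> reduce n Q = reduce n (P * Q)"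
proof -
  have "reduce n P \<otimes>\<^bsub>Zpoly n\<^esub> reduce n Q =
      (\<lambda>k. \<Oplus>\<^bsub>Zmod n\<^esub>i\<in>{..k}. reduce n P i \<otimes>\<^bsub>Zmod n\<^esub> reduce n Q (k - i))"
    by (simp add: UP_def)
  also have "\<dots> = reduce n (P * Q)"
    by (simp add: reduce_def mult_cong sum_cong Polynomial.coeff_mult)
  finally show ?thesis .
qed

lemma reduce_0: "reduce n 0 = \<zero>\<^bsub>Zpoly n\<^esub>"
  by (simp add: reduce_def UP_def zero_cong)

lemma reduce_1: "reduce n 1 = \<one>\<^bsub>Zpoly n\<^esub>"
  using n by (auto simp: reduce_def UP_def zero_cong res_one_eq fun_eq_iff)

lemma reduce_sum:
  "finite A \<Longrightarrow> (\<Oplus>\<^bsub>Zpoly n\<^esub>k\<in>A. reduce n (f k)) = reduce n (\<Sum>k\<in>A. f k)"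
  by (induction A rule: finite_induct) (simp_all add: reduce_0 reduce_add Pi_def)

lemma reduce_prod:
  "finite A \<Longrightarrow> (\<Otimes>\<^bsub>Zpoly n\<^esub>k\<in>A. reduce n (f k)) = reduce n (\<Prod>k\<in>A. f k)"
  by (induction A rule: finite_induct) (simp_all add: reduce_1 reduce_mult Pi_def)

lemma reduce_smult: "(c mod int n) \<odot>\<^bsub>Zpoly n\<^esub> reduce n P = reduce n (smult c P)"
proof -
  have "c mod int n \<in> carrier (Zmod n)"
    using n by (simp add: residue_ring_def)
  then show ?thesis
    using reduce_in_up[of P] by (simp add: UP_def) (simp add: reduce_def mult_cong)
qed

lemma reduce_monom:
  "up_ring.monom (Zpoly n) (c mod int n) k = reduce n (Polynomial.monom c k)"
proof -
  have "c mod int n \<in> carrier (Zmod n)"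
    using n by (simp add: residue_ring_def)
  then show ?thesis
    by (auto simp: UP_def reduce_def zero_cong fun_eq_iff)
qed

lemma basic_null_poly_eq_reduce: "basic_null_poly n k = reduce n (int_basic n k)"
proof -
  have "up_ring.monom (Zpoly n) \<one>\<^bsub>Zmod n\<^esub> 1 \<oplus>\<^bsub>Zpoly n\<^esub>
      up_ring.monom (Zpoly n) (int i mod int n) 0 = reduce n [:int i, 1:]" for i
    unfolding one_cong reduce_monom reduce_add
    by (simp add: monom_altdef)
  then show ?thesis
    by (simp add: basic_null_poly_def reduce_prod reduce_smult int_basic_def rising_def)
qed

lemma null_polynomial_dvd_poly:
  assumes "null_polynomial n p"
  shows "int n dvd poly (Abs_poly p) x"
proof -
  have p: "p \<in> carrier (Zpoly n)"
    and ev: "eval (Zmod n) (Zmod n) id (x mod int n) p = \<zero>\<^bsub>Zmod n\<^esub>"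
    using assms n by (auto simp: null_polynomial_def residue_ring_def)
  let ?P = "Abs_poly p"
  have "up_ring.coeff (Zpoly n) p i = poly.coeff ?P i mod int n" for i
    using p by (simp add: UP_def coeff_Abs_carrier[OF p] carrier_coeff_mod[OF p])
  then have "eval (Zmod n) (Zmod n) id (x mod int n) p = poly ?P x mod int n"
    using p by (simp add: eval_def deg_eq_degree pow_cong mult_cong sum_cong poly_altdef)
  with ev show ?thesis by (simp add: zero_cong mod_eq_0_iff_dvd)
qed

lemma decomposition_iff:
  assumes p: "p \<in> carrier (Zpoly n)"
    and q: "\<And>k. k \<in> {1..num_basic n} \<Longrightarrow> q k \<in> carrier (Zpoly (m k))"
  shows "p = (\<Oplus>\<^bsub>Zpoly n\<^esub> k\<in>{1..num_basic n}. lift_poly n (q k) \<otimes>\<^bsub>Zpoly n\<^esub> basic_null_poly n k)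
    \<longleftrightarrow> [:int n:] dvd Abs_poly p - (\<Sum>k\<in>{1..num_basic n}. Abs_poly (q k) * int_basic n k)"
proof -
  have "(\<Oplus>\<^bsub>Zpoly n\<^esub> k\<in>{1..num_basic n}. lift_poly n (q k) \<otimes>\<^bsub>Zpoly n\<^esub> basic_null_poly n k) =
      (\<Oplus>\<^bsub>Zpoly n\<^esub> k\<in>{1..num_basic n}. reduce n (Abs_poly (q k) * int_basic n k))"
    by (rule P.finsum_cong') (auto simp: lift_poly_eq_reduce[OF q] basic_null_poly_eq_reduce reduce_mult)
  also have "\<dots> = reduce n (\<Sum>k\<in>{1..num_basic n}. Abs_poly (q k) * int_basic n k)"
    by (rule reduce_sum) simp
  finally show ?thesis
    using reduce_Abs_carrier[OF p] by (metis reduce_eq_iff)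
qed

end

section \<open>The decomposition theorem\<close>

text \<open>
  At and above the degree \<open>\<beta>\<^sub>1\<close>, \<open>p\<close> agrees modulo \<open>n\<close> with the product of \<open>q\<^sub>1\<close> and the monic
  polynomial \<open>b\<^sub>1\<close>, so the degree of \<open>p\<close> is that of this product, or below \<open>\<beta>\<^sub>1\<close> if \<open>q\<^sub>1 = 0\<close>.
\<close>

lemma degree_leading_quotient:
  assumes n: "n \<ge> 2"
    and p: "p \<in> carrier (Zpoly n)"
    and q1: "q 1 \<in> carrier (Zpoly n)"
    and eq: "[:int n:] dvd Abs_poly p - (\<Sum>k\<in>{1..num_basic n}. Abs_poly (q k) * int_basic n k)"
    and q: "\<And>k i. k \<in> {1<..num_basic n} \<Longrightarrow> i \<ge> beta n (k - 1) - beta n k \<Longrightarrow>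
      poly.coeff (Abs_poly (q k)) i = 0"
  shows "if degree_ext (Zmod n) p < ereal (real (beta n 1)) then q 1 = \<zero>\<^bsub>Zpoly n\<^esub>
    else degree_ext (Zmod n) (q 1) = degree_ext (Zmod n) p - ereal (real (beta n 1))"
proof -
  let ?P = "Abs_poly p" and ?Q = "Abs_poly (q 1)" and ?b = "beta n 1"
  let ?f = "\<lambda>k. Abs_poly (q k) * int_basic n k"
  have "{1..num_basic n} = insert 1 {1<..num_basic n}"
    using num_basic_ge_1[OF n] by auto
  then have "sum ?f {1..num_basic n} = ?f 1 + sum ?f {1<..num_basic n}"
    by simp
  then have eq': "int n dvd poly.coeff ?P i - (poly.coeff (?Q * rising ?b) i +
      poly.coeff (sum ?f {1<..num_basic n}) i)" for i
    using eq alpha_1[OF n] by (simp add: const_poly_dvd_iff int_basic_def)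
  have tail: "poly.coeff (sum ?f {1<..num_basic n}) i = 0" if "i \<ge> ?b" for i
    using n q that by (intro coeff_tail_eq_0) auto
  have P: "poly.coeff ?P i = poly.coeff (?Q * rising ?b) i mod int n" if "i \<ge> ?b" for i
  proof -
    have "int n dvd poly.coeff ?P i - poly.coeff (?Q * rising ?b) i"
      using eq'[of i] by (simp only: tail[OF that] add_0_right)
    then show ?thesis
      using carrier_coeff_mod[OF p, of i]
      by (simp add: coeff_Abs_carrier[OF p] flip: mod_eq_dvd_iff)
  qed
  show ?thesis
  proof (cases "?Q = 0")
    case True
    then have "q 1 = \<zero>\<^bsub>Zpoly n\<^esub>"
      using reduce_Abs_carrier[OF q1] reduce_0[OF n] by simp
    moreover have "degree_ext (Zmod n) p < ereal (real ?b)"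
      unfolding degree_ext_less_iff[OF p] using P True by simp
    ultimately show ?thesis by simp
  next
    case False
    have lead: "poly.coeff ?P (degree ?Q + ?b) \<noteq> 0"
    proof -
      have "poly.coeff ?P (degree ?Q + ?b) = lead_coeff ?Q mod int n"
        using P[of "degree ?Q + ?b"] coeff_mult_degree_sum[of ?Q "rising ?b"] lead_coeff_rising[of ?b]
        by simp
      also have "\<dots> = lead_coeff ?Q"
        by (simp only: coeff_Abs_carrier[OF q1] carrier_coeff_mod[OF q1])
      finally show ?thesis using False by simp
    qed
    have above: "poly.coeff ?P i = 0" if "i > degree ?Q + ?b" for i
      using P[of i] coeff_mult_eq_0_above[of "Suc (degree ?Q)" ?Q "rising ?b" i] that
      by (simp add: coeff_eq_0)
    have "degree ?P = degree ?Q + ?b"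
      using le_degree[OF lead] degree_le[of "degree ?Q + ?b" ?P] above by auto
    moreover have "?P \<noteq> 0" using lead by auto
    ultimately show ?thesis
      using False by (simp add: degree_ext_eq[OF p] degree_ext_eq[OF q1] del: One_nat_def)
  qed
qed

theorem theorem8:
  fixes n :: nat and p :: "nat \<Rightarrow> int"
  assumes "n \<ge> 2" and "null_polynomial n p"
  shows "\<exists>!q. q \<in> (\<Pi>\<^sub>E k\<in>{1..num_basic n}. carrier (Zpoly (n div alpha n k))) \<and>
     p = (\<Oplus>\<^bsub>Zpoly n\<^esub> k \<in> {1..num_basic n}. lift_poly n (q k) \<otimes>\<^bsub>Zpoly n\<^esub> basic_null_poly n k) \<and>
     (\<forall>k \<in> {1<..num_basic n}.
        degree_ext (Zmod (n div alpha n k)) (q k) < ereal (real (beta n (k - 1)) - real (beta n k))) \<and>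
     (if degree_ext (Zmod n) p < ereal (real (beta n 1))
      then q 1 = \<zero>\<^bsub>Zpoly (n div alpha n 1)\<^esub>
      else degree_ext (Zmod (n div alpha n 1)) (q 1) = degree_ext (Zmod n) p - ereal (real (beta n 1)))"
proof -
  note n = assms(1)
  define K where "K = {1..num_basic n}"
  define m where "m = (\<lambda>k. n div alpha n k)"
  have m1: "m 1 = n" using alpha_1[OF n] by (simp add: m_def)
  have m_pos: "m k > 0" for k using n by (simp add: m_def div_alpha)
  have p: "p \<in> carrier (Zpoly n)" using assms(2) by (simp add: null_polynomial_def)
  have one: "1 \<in> K" using num_basic_ge_1[OF n] by (simp add: K_def)
  have real_diff: "real (beta n (k - 1)) - real (beta n k) = real (beta n (k - 1) - beta n k)"
    if "k \<in> {1<..num_basic n}" for k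
  proof -
    have "beta n k < beta n (k - 1)"
      using that n by (intro beta_strict_decreasing) auto
    then show ?thesis by (simp add: of_nat_diff)
  qed
  define small where "small = (\<lambda>q. \<forall>k\<in>{1<..num_basic n}. \<forall>i\<ge>beta n (k - 1) - beta n k.
    poly.coeff (Abs_poly (q k :: nat \<Rightarrow> int)) i = 0)"
  define valid where "valid = (\<lambda>q. q \<in> (\<Pi>\<^sub>E k\<in>K. carrier (Zpoly (m k))) \<and>
    [:int n:] dvd Abs_poly p - (\<Sum>k\<in>K. Abs_poly (q k) * int_basic n k) \<and> small q)"
  \<comment> \<open>The conditions in terms of integer polynomials. The degree of \<open>q\<^sub>1\<close> is a consequence of these.\<close>
  have valid_iff: "q \<in> (\<Pi>\<^sub>E k\<in>{1..num_basic n}. carrier (Zpoly (n div alpha n k))) \<and>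
     p = (\<Oplus>\<^bsub>Zpoly n\<^esub> k \<in> {1..num_basic n}. lift_poly n (q k) \<otimes>\<^bsub>Zpoly n\<^esub> basic_null_poly n k) \<and>
     (\<forall>k \<in> {1<..num_basic n}.
        degree_ext (Zmod (n div alpha n k)) (q k) < ereal (real (beta n (k - 1)) - real (beta n k))) \<and>
     (if degree_ext (Zmod n) p < ereal (real (beta n 1))
      then q 1 = \<zero>\<^bsub>Zpoly (n div alpha n 1)\<^esub>
      else degree_ext (Zmod (n div alpha n 1)) (q 1) = degree_ext (Zmod n) p - ereal (real (beta n 1)))
     \<longleftrightarrow> valid q" (is "?A \<and> ?B \<and> ?C \<and> ?D \<longleftrightarrow> _") for q
  proof (cases ?A)
    case True
    then have q: "q k \<in> carrier (Zpoly (m k))" if "k \<in> {1..num_basic n}" for k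
      using that by (auto simp: m_def)
    have "?B \<longleftrightarrow> [:int n:] dvd Abs_poly p - (\<Sum>k\<in>K. Abs_poly (q k) * int_basic n k)"
      unfolding K_def by (rule decomposition_iff[OF n p q])
    moreover have "?C \<longleftrightarrow> small q"
      unfolding small_def
    proof (rule ball_cong[OF refl])
      fix k assume k: "k \<in> {1<..num_basic n}"
      then have "q k \<in> carrier (Zpoly (n div alpha n k))"
        using q[of k] by (simp add: m_def)
      from degree_ext_less_iff[OF this] show "(degree_ext (Zmod (n div alpha n k)) (q k)
          < ereal (real (beta n (k - 1)) - real (beta n k))) =
        (\<forall>i\<ge>beta n (k - 1) - beta n k. poly.coeff (Abs_poly (q k)) i = 0)"
        unfolding real_diff[OF k] .
    qed
    moreover have ?D if "valid q"
    proof -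
      have q1: "q 1 \<in> carrier (Zpoly n)" using q[of 1] one m1 by (simp add: K_def)
      show ?thesis
        using degree_leading_quotient[where q = q, OF n p q1] that m1
        by (simp add: valid_def small_def K_def m_def del: One_nat_def)
    qed
    ultimately show ?thesis
      using True unfolding valid_def K_def m_def by blast
  next
    case False
    then show ?thesis unfolding valid_def K_def m_def by blast
  qed
  have "\<exists>!q. valid q"
  proof (rule ex_ex1I)
    obtain Q where
      Q: "[:int n:] dvd Abs_poly p - (\<Sum>k\<in>K. Q k * int_basic n k)"
        "\<forall>k\<in>{1<..num_basic n}. \<forall>i\<ge>beta n (k - 1) - beta n k. poly.coeff (Q k) i = 0"
      using null_decomposition_ex[OF n, of "Abs_poly p" "Suc (degree (Abs_poly p))"]
        null_polynomial_dvd_poly[OF n assms(2)]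
      by (auto simp: K_def coeff_eq_0)
    \<comment> \<open>Changing \<open>Q\<^sub>k\<close> by a multiple of \<open>n / \<alpha>\<^sub>k\<close> changes its product with \<open>b\<^sub>k\<close> by a multiple of \<open>n\<close>.\<close>
    define q where "q = (\<lambda>k\<in>K. reduce (m k) (Q k))"
    have qc: "q k \<in> carrier (Zpoly (m k))" if "k \<in> K" for k
      using that by (simp add: q_def reduce_carrier m_pos)
    have "[:int n:] dvd (\<Sum>k\<in>K. (Q k - Abs_poly (q k)) * int_basic n k)"
    proof (rule dvd_sum)
      fix k assume k: "k \<in> K"
      have "reduce (m k) (Q k) = reduce (m k) (Abs_poly (q k))"
        using reduce_Abs_carrier[OF qc[OF k]] k by (simp add: q_def)
      then have "[:int (m k):] dvd Q k - Abs_poly (q k)"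
        by (simp add: reduce_eq_iff)
      moreover have "[:int (alpha n k):] dvd int_basic n k"
        by (simp add: const_poly_dvd_iff int_basic_def)
      ultimately have "[:int (m k):] * [:int (alpha n k):] dvd (Q k - Abs_poly (q k)) * int_basic n k"
        by (rule mult_dvd_mono)
      moreover have "m k * alpha n k = n"
        using alpha_mult_gcd[of n k] n by (simp add: m_def div_alpha mult.commute)
      then have "[:int (m k):] * [:int (alpha n k):] = [:int n:]"
        by (simp add: mult.commute flip: of_nat_mult)
      ultimately show "[:int n:] dvd (Q k - Abs_poly (q k)) * int_basic n k"
        by simp
    qed
    from dvd_add[OF Q(1) this]
    have "[:int n:] dvd Abs_poly p - (\<Sum>k\<in>K. Abs_poly (q k) * int_basic n k)"
      by (simp add: left_diff_distrib sum_subtractf)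
    moreover have "small q"
      unfolding small_def
    proof (intro ballI allI impI)
      fix k i assume k: "k \<in> {1<..num_basic n}" and i: "beta n (k - 1) - beta n k \<le> i"
      then have "k \<in> K" by (auto simp: K_def)
      with k i Q(2) show "poly.coeff (Abs_poly (q k)) i = 0"
        using coeff_Abs_carrier[OF qc[of k]] by (simp add: q_def reduce_def)
    qed
    moreover have "q \<in> (\<Pi>\<^sub>E k\<in>K. carrier (Zpoly (m k)))"
      using qc by (auto simp: q_def)
    ultimately show "\<exists>q. valid q" unfolding valid_def by blast
  next
    fix q q' assume v: "valid q" "valid q'"
    show "q = q'"
    proof (rule PiE_ext)
      show mem: "q \<in> (\<Pi>\<^sub>E k\<in>K. carrier (Zpoly (m k)))" "q' \<in> (\<Pi>\<^sub>E k\<in>K. carrier (Zpoly (m k)))"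
        using v by (auto simp: valid_def)
      define D where "D = (\<lambda>k. Abs_poly (q k) - Abs_poly (q' k))"
      have "[:int n:] dvd (\<Sum>k\<in>K. D k * int_basic n k)"
        using dvd_diff[of "[:int n:]" "Abs_poly p - (\<Sum>k\<in>K. Abs_poly (q' k) * int_basic n k)"
            "Abs_poly p - (\<Sum>k\<in>K. Abs_poly (q k) * int_basic n k)"] v
        by (simp add: valid_def D_def left_diff_distrib sum_subtractf)
      moreover have "poly.coeff (D k) i = 0"
        if "k \<in> {1<..num_basic n}" "i \<ge> beta n (k - 1) - beta n k" for k i
        using v that by (simp add: valid_def small_def D_def)
      ultimately have D: "[:int (m k):] dvd D k" if "k \<in> K" for k
        using decomposition_unique[OF n, of D k] that by (simp add: K_def m_def)
      fix k assume k: "k \<in> K"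
      have "reduce (m k) (Abs_poly (q k)) = reduce (m k) (Abs_poly (q' k))"
        using D[OF k] by (simp add: reduce_eq_iff D_def)
      then show "q k = q' k"
        using PiE_mem[OF mem(1) k] PiE_mem[OF mem(2) k] by (simp add: reduce_Abs_carrier)
    qed
  qed
  then show ?thesis unfolding valid_iff .
qed

end
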